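(* Let $S,P,Q$ be pairwise disjoint finite sets and consider the equation $\mathcal{K}_{SP}\leftrightarrow\mathcal{K}_{PQ}=\mathcal{K}_{SQ}$, where $\mathcal{K}_{SP},\mathcal{K}_{PQ},\mathcal{K}_{SQ}$ are generalized number lattices on $S\uplus P$, $P\uplus Q$, $S\uplus Q$ respectively. Then 1. given $\mathcal{K}_{SP},\mathcal{K}_{SQ}$, there exists a generalized number lattice $\mathcal{K}_{PQ}$ satisfying the equation iff $\mathcal{K}_{SP}\circ S\supseteq\mathcal{K}_{SQ}\circ S$ and $\mathcal{K}_{SP}\times S\subseteq\mathcal{K}_{SQ}\times S$; 2. given $\mathcal{K}_{SP},\mathcal{K}_{PQ},\mathcal{K}_{SQ}$ satisfying the equation, we have $\mathcal{K}_{SP}\leftrightarrow\mathcal{K}_{SQ}=\mathcal{K}_{PQ}$ iff $\mathcal{K}_{SP}\circ P\supseteq\mathcal{K}_{PQ}\circ P$ and $\mathcal{K}_{SP}\times P\subseteq\mathcal{K}_{PQ}\times P$; 3. given $\mathcal{K}_{SP},\mathcal{K}_{SQ}$, if the equation is satisfied by some generalized number lattice $\hat{\mathcal{K}}_{PQ}$ with $\mathcal{K}_{SP}\circ P\supseteq\hat{\mathcal{K}}_{PQ}\circ P$ and $\mathcal{K}_{SP}\times P\subseteq\hat{\mathcal{K}}_{PQ}\times P$, then it is the unique such solution.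
   Context: All vectors are over $\mathbb{Q}$; a vector on a finite set $X$ is a function $X\to\mathbb{Q}$, $0_X$ the zero vector, $(f_X,g_Y)$ the vector on $X\uplus Y$ formed from $f_X,g_Y$. A number lattice on $X$ is the set of all integer linear combinations of finitely many vectors on $X$; a generalized number lattice on $X$ is a set $L_X+\mathcal{V}_X$ with $L_X$ a number lattice and $\mathcal{V}_X$ a vector subspace. Restriction: $\mathcal{K}_{SP}\circ S=\{f_S:\exists f_P,(f_S,f_P)\in\mathcal{K}_{SP}\}$; contraction: $\mathcal{K}_{SP}\times S=\{f_S:(f_S,0_P)\in\mathcal{K}_{SP}\}$. Matched composition of $\mathcal{K}_{AB},\mathcal{K}_{BC}$ ($A,B,C$ pairwise disjoint, sets of vectors indexed by sets so $\mathcal{K}_{AB}=\mathcal{K}_{BA}$): $\mathcal{K}_{AB}\leftrightarrow\mathcal{K}_{BC}=\{(f_A,g_C):\exists h_B,\ (f_A,h_B)\in\mathcal{K}_{AB},(h_B,g_C)\in\mathcal{K}_{BC}\}$. *)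

theory Defs
  imports Complex_Main "HOL-Library.Function_Algebras"
begin

(* A vector on X, i.e. a function X -> Q, is encoded by its extension by zero to the whole type.
   Hence the zero vector on any set is 0, and for disjoint X, Y the vector (f_X, g_Y) on the
   union of X and Y is the pointwise sum f + g. *)
definition vecs :: "'a set \<Rightarrow> ('a \<Rightarrow> rat) set" where
  "vecs X = {f. \<forall>x. x \<notin> X \<longrightarrow> f x = 0}"

definition vscale :: "rat \<Rightarrow> ('a \<Rightarrow> rat) \<Rightarrow> 'a \<Rightarrow> rat" where
  "vscale c f = (\<lambda>x. c * f x)"

interpretation ratvec: vector_space "vscale :: rat \<Rightarrow> ('a \<Rightarrow> rat) \<Rightarrow> 'a \<Rightarrow> rat"
  by unfold_locales (simp_all add: vscale_def fun_eq_iff algebra_simps)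

definition number_lattice :: "'a set \<Rightarrow> ('a \<Rightarrow> rat) set \<Rightarrow> bool" where
  "number_lattice X L \<longleftrightarrow>
    (\<exists>B. finite B \<and> B \<subseteq> vecs X \<and>
         L = {(\<Sum>b\<in>B. vscale (rat_of_int (c b)) b) | c :: ('a \<Rightarrow> rat) \<Rightarrow> int. True})"

definition gen_number_lattice :: "'a set \<Rightarrow> ('a \<Rightarrow> rat) set \<Rightarrow> bool" where
  "gen_number_lattice X K \<longleftrightarrow>
    (\<exists>L V. number_lattice X L \<and> V \<subseteq> vecs X \<and> ratvec.subspace V \<and>
           K = {l + v | l v. l \<in> L \<and> v \<in> V})"

(* In the next two definitions K is a set of vectors on the disjoint union of S and P,
   and the result is a set of vectors on S. *)
definition restriction :: "('a \<Rightarrow> rat) set \<Rightarrow> 'a set \<Rightarrow> 'a set \<Rightarrow> ('a \<Rightarrow> rat) set" where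
  "restriction K S P = {f \<in> vecs S. \<exists>g \<in> vecs P. f + g \<in> K}"

(* (f_S, 0_P) is f itself, so P does not occur. *)
definition contraction :: "('a \<Rightarrow> rat) set \<Rightarrow> 'a set \<Rightarrow> ('a \<Rightarrow> rat) set" where
  "contraction K S = {f \<in> vecs S. f \<in> K}"

definition matched_comp ::
  "'a set \<Rightarrow> 'a set \<Rightarrow> 'a set \<Rightarrow> ('a \<Rightarrow> rat) set \<Rightarrow> ('a \<Rightarrow> rat) set \<Rightarrow> ('a \<Rightarrow> rat) set" where
  "matched_comp A B C K\<^sub>1 K\<^sub>2 =
    {f + g | f g. f \<in> vecs A \<and> g \<in> vecs C \<and>
                  (\<exists>h \<in> vecs B. f + h \<in> K\<^sub>1 \<and> h + g \<in> K\<^sub>2)}"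

end

theory Submission
  imports Defs
begin

text \<open>
  Composing with \<open>K_SP\<close> twice returns any subgroup \<open>K_SQ\<close> that satisfies the restriction and
  contraction inclusions. Hence \<open>K_SP \<leftrightarrow> K_SQ\<close> is the candidate solution, and the second and third
  claims are the same statement with \<open>S\<close> and \<open>P\<close> exchanged. What remains is that the composition
  of generalized number lattices is one. The composition is a projection of the intersection of two
  generalized number lattices, and intersections are handled by the fact that subgroups of finitely
  generated abelian groups are finitely generated, relative to a subspace.
\<close>

section \<open>Generalized number lattices as subgroups of rational vectors\<close>

text \<open>Rational vectors also form a module over the integers. For this module the library
  notion of span is the set of integer combinations, and a subspace is a subgroup.\<close>

interpretation intvec: module "\<lambda>n :: int. vscale (rat_of_int n) :: ('a \<Rightarrow> rat) \<Rightarrow> 'a \<Rightarrow> rat"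
  by unfold_locales (simp_all add: vscale_def fun_eq_iff algebra_simps)

lemma number_lattice_iff_span:
  "number_lattice X L \<longleftrightarrow> (\<exists>B. finite B \<and> B \<subseteq> vecs X \<and> L = intvec.span B)"
  unfolding number_lattice_def by (auto simp: intvec.span_finite full_SetCompr_eq)

lemma gen_number_lattice_iff_span:
  "gen_number_lattice X K \<longleftrightarrow>
    (\<exists>B V. finite B \<and> B \<subseteq> vecs X \<and> V \<subseteq> vecs X \<and> ratvec.subspace V \<and>
      K = {l + v | l v. l \<in> intvec.span B \<and> v \<in> V})"
  unfolding gen_number_lattice_def number_lattice_iff_span by blast

lemma subspace_vecs: "ratvec.subspace (vecs X)"
  by (auto simp: ratvec.subspace_def vecs_def vscale_def)

lemma intvec_subspace_if_ratvec_subspace: "ratvec.subspace V \<Longrightarrow> intvec.subspace V"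
  by (auto simp: ratvec.subspace_def intvec.subspace_def)

lemma intvec_subspace_sums:
  assumes "intvec.subspace U" "intvec.subspace V"
  shows "intvec.subspace {u + v | u v. u \<in> U \<and> v \<in> V}"
  using intvec.subspace_span[of "U \<union> V"] assms
  by (simp only: intvec.span_Un intvec.span_eq_iff[THEN iffD2])

lemma gen_number_lattice_imp_subspace: "gen_number_lattice X K \<Longrightarrow> intvec.subspace K"
  unfolding gen_number_lattice_iff_span
  using intvec_subspace_sums[OF intvec.subspace_span intvec_subspace_if_ratvec_subspace] by blast

lemma gen_number_lattice_imp_vecs:
  assumes "gen_number_lattice X K" shows "K \<subseteq> vecs X"
proof -
  obtain B V where B: "B \<subseteq> vecs X" and V: "V \<subseteq> vecs X"
    and K: "K = {l + v | l v. l \<in> intvec.span B \<and> v \<in> V}"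
    using assms unfolding gen_number_lattice_iff_span by blast
  have sub: "intvec.subspace (vecs X)"
    by (rule intvec_subspace_if_ratvec_subspace[OF subspace_vecs])
  have "intvec.span B \<subseteq> vecs X" by (rule intvec.span_minimal[OF B sub])
  then show ?thesis using K V intvec.subspace_add[OF sub] by blast
qed

section \<open>Finite generation of subgroups modulo a subgroup\<close>

lemma int_subgroup_principal:
  fixes I :: "int set"
  assumes zero: "0 \<in> I" and diff: "\<And>a b. a \<in> I \<Longrightarrow> b \<in> I \<Longrightarrow> a - b \<in> I"
  obtains d where "d \<in> I" "\<And>n. n \<in> I \<Longrightarrow> d dvd n"
proof (cases "I \<subseteq> {0}")
  case True
  then show thesis using that[of 0] zero by auto
next
  case False
  then obtain m where m: "m \<in> I" "m \<noteq> 0" by auto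
  have neg: "- a \<in> I" if "a \<in> I" for a using diff[OF zero that] by simp
  have add: "a + b \<in> I" if "a \<in> I" "b \<in> I" for a b using diff[OF that(1) neg[OF that(2)]] by simp
  have nmult: "int k * a \<in> I" if "a \<in> I" for k a
    by (induction k) (auto simp: zero algebra_simps intro: add that)
  have mult: "k * a \<in> I" if "a \<in> I" for k a
    using nmult[OF that, of "nat \<bar>k\<bar>"] neg[OF nmult[OF that, of "nat \<bar>k\<bar>"]]
    by (cases "k \<ge> 0") auto
  define P where "P k \<longleftrightarrow> 0 < k \<and> int k \<in> I" for k :: nat
  have "P (nat \<bar>m\<bar>)" using m neg by (auto simp: P_def abs_if)
  \<comment> \<open>The generator is the least positive element. Remainders on division by it stay
    in \<open>I\<close> and are smaller, so they vanish.\<close>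
  then have d: "P (LEAST k. P k)" by (rule LeastI)
  let ?d = "int (LEAST k. P k)"
  have "?d dvd n" if n: "n \<in> I" for n
  proof -
    have "n mod ?d \<in> I" using diff[OF n mult[of ?d "n div ?d"]] d
      by (simp add: P_def minus_div_mult_eq_mod)
    moreover have lt: "0 \<le> n mod ?d" "n mod ?d < ?d" using d by (auto simp: P_def)
    ultimately have "n mod ?d = 0"
      using not_less_Least[of "nat (n mod ?d)" P] by (force simp: P_def)
    then show ?thesis by auto
  qed
  then show thesis using that d by (auto simp: P_def)
qed

text \<open>Induction on the generators: the coefficients that elements of \<open>H\<close> can have
  at a new generator \<open>b\<close> are the multiples of some \<open>d\<close>. One element of
  \<open>H\<close> realizing \<open>d\<close> reduces every other to the part of \<open>H\<close>
  that avoids \<open>b\<close>. The remainder ranges over \<open>V \<inter> H\<close> because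
  \<open>H\<close> may fail to contain \<open>V\<close>.\<close>

lemma subgroup_finitely_generated_modulo:
  fixes H V :: "('a \<Rightarrow> rat) set"
  assumes "finite B" and V: "intvec.subspace V" and "intvec.subspace H"
    and "H \<subseteq> {l + v | l v. l \<in> intvec.span B \<and> v \<in> V}"
  shows "\<exists>C. finite C \<and> C \<subseteq> H \<and> H = {l + v | l v. l \<in> intvec.span C \<and> v \<in> V \<inter> H}"
  using assms(1,3,4)
proof (induction B arbitrary: H rule: finite_induct)
  case empty
  then have "H \<subseteq> V" by auto
  then show ?case by (intro exI[of _ "{}"]) (auto simp: Int_absorb1)
next
  case (insert b B)
  let ?s = "\<lambda>n. vscale (rat_of_int n)"
  let ?A = "{l + v | l v. l \<in> intvec.span B \<and> v \<in> V}"
  note H = \<open>intvec.subspace H\<close>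
  have A: "intvec.subspace ?A"
    by (intro intvec_subspace_sums intvec.subspace_span V)
  \<comment> \<open>An element may have several coefficients at \<open>b\<close>, since its
    representation need not be unique; \<open>I\<close> collects all of them.\<close>
  define I where "I = {n. \<exists>h\<in>H. h - ?s n b \<in> ?A}"
  have coeff: "\<exists>n. h - ?s n b \<in> ?A" if h: "h \<in> H" for h
  proof -
    obtain l v where lv: "h = l + v" "l \<in> intvec.span (insert b B)" "v \<in> V"
      using h insert.prems(2) by blast
    then obtain n where "l - ?s n b \<in> intvec.span B"
      by (auto simp: intvec.span_breakdown_eq)
    moreover have "h - ?s n b = (l - ?s n b) + v" using lv by simp
    ultimately show ?thesis using lv by blast
  qed
  have "0 - ?s 0 b \<in> ?A"
    using intvec.subspace_0[OF A] by (simp only: intvec.scale_zero_left diff_0_right)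
  then have "0 \<in> I" using intvec.subspace_0[OF H] unfolding I_def by blast
  moreover have "m - n \<in> I" if mn: "m \<in> I" "n \<in> I" for m n
  proof -
    obtain h k where "h \<in> H" "h - ?s m b \<in> ?A" "k \<in> H" "k - ?s n b \<in> ?A"
      using mn unfolding I_def by blast
    moreover have "(h - k) - ?s (m - n) b = (h - ?s m b) - (k - ?s n b)"
      by (simp add: vscale_def fun_eq_iff algebra_simps)
    ultimately show ?thesis
      using intvec.subspace_diff[OF H] intvec.subspace_diff[OF A] unfolding I_def
      by (metis (no_types, lifting) mem_Collect_eq)
  qed
  ultimately obtain d where "d \<in> I" and d: "\<And>n. n \<in> I \<Longrightarrow> d dvd n"
    using int_subgroup_principal[of I] by metis
  then obtain h0 where h0: "h0 \<in> H" "h0 - ?s d b \<in> ?A" unfolding I_def by blast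
  \<comment> \<open>The induction hypothesis is applied to the elements of \<open>H\<close> that can
    be written without \<open>b\<close>.\<close>
  obtain C where C: "finite C" "C \<subseteq> H \<inter> ?A"
    and HA: "H \<inter> ?A = {l + v | l v. l \<in> intvec.span C \<and> v \<in> V \<inter> (H \<inter> ?A)}"
    using insert.IH[of "H \<inter> ?A"] intvec.subspace_inter[OF H A] by blast
  have "h \<in> {l + v | l v. l \<in> intvec.span (insert h0 C) \<and> v \<in> V \<inter> H}" if h: "h \<in> H" for h
  proof -
    obtain n where n: "h - ?s n b \<in> ?A" using coeff[OF h] by blast
    then have "n \<in> I" using h unfolding I_def by blast
    then obtain k where k: "n = d * k" using d by blast
    \<comment> \<open>Since \<open>n = d * k\<close>, subtracting \<open>k\<close> copies of
      \<open>h0\<close> cancels the multiple of \<open>b\<close>.\<close>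
    have "h - ?s k h0 = (h - ?s n b) - ?s k (h0 - ?s d b)"
      by (simp add: k vscale_def fun_eq_iff algebra_simps)
    then have "h - ?s k h0 \<in> ?A"
      using intvec.subspace_diff[OF A n intvec.subspace_scale[OF A h0(2), of k]] by (simp only:)
    then have "h - ?s k h0 \<in> H \<inter> ?A"
      using intvec.subspace_diff[OF H h intvec.subspace_scale[OF H h0(1)]] by blast
    then obtain l v where lv: "h - ?s k h0 = l + v" "l \<in> intvec.span C" "v \<in> V \<inter> H"
      using HA by blast
    have "h = (?s k h0 + l) + v" using lv(1) by (simp add: algebra_simps)
    moreover have "?s k h0 + l \<in> intvec.span (insert h0 C)"
      using lv(2) by (auto simp: intvec.span_breakdown_eq intro!: exI[of _ k])
    ultimately show ?thesis using lv(3) by blast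
  qed
  moreover have "{l + v | l v. l \<in> intvec.span (insert h0 C) \<and> v \<in> V \<inter> H} \<subseteq> H"
    using intvec.span_minimal[OF _ H, of "insert h0 C"] C(2) h0(1) intvec.subspace_add[OF H]
    by blast
  ultimately show ?case
    using C h0(1) by (intro exI[of _ "insert h0 C"]) blast
qed

section \<open>Closure of generalized number lattices under intersection, extension and
  projection\<close>

text \<open>Reducing \<open>K \<inter> M\<close> modulo \<open>V\<close> leaves the remainder
  \<open>V \<inter> M\<close>, which need not be a subspace. Reducing that modulo \<open>W\<close>
  leaves \<open>V \<inter> W\<close>, which is one. The two finite generating sets together span the
  lattice part.\<close>

lemma gen_number_lattice_Int:
  assumes "gen_number_lattice X K" and "gen_number_lattice X M"
  shows "gen_number_lattice X (K \<inter> M)"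
proof -
  obtain B V where B: "finite B" and V: "V \<subseteq> vecs X" "ratvec.subspace V"
    and K: "K = {l + v | l v. l \<in> intvec.span B \<and> v \<in> V}"
    using assms(1) unfolding gen_number_lattice_iff_span by blast
  obtain D W where D: "finite D" and W: "W \<subseteq> vecs X" "ratvec.subspace W"
    and M: "M = {l + v | l v. l \<in> intvec.span D \<and> v \<in> W}"
    using assms(2) unfolding gen_number_lattice_iff_span by blast
  note V' = intvec_subspace_if_ratvec_subspace[OF V(2)]
  note W' = intvec_subspace_if_ratvec_subspace[OF W(2)]
  note subK = gen_number_lattice_imp_subspace[OF assms(1)]
  note subM = gen_number_lattice_imp_subspace[OF assms(2)]
  have VK: "V \<subseteq> K" using intvec.span_zero[of B] by (force simp: K)
  have WM: "W \<subseteq> M" using intvec.span_zero[of D] by (force simp: M)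
  obtain C1 where C1: "finite C1" "C1 \<subseteq> K \<inter> M"
    "K \<inter> M = {l + v | l v. l \<in> intvec.span C1 \<and> v \<in> V \<inter> (K \<inter> M)}"
    using subgroup_finitely_generated_modulo[OF B V' intvec.subspace_inter[OF subK subM]] K
    by blast
  obtain C2 where C2: "finite C2" "C2 \<subseteq> V \<inter> M"
    "V \<inter> M = {l + v | l v. l \<in> intvec.span C2 \<and> v \<in> W \<inter> (V \<inter> M)}"
    using subgroup_finitely_generated_modulo[OF D W' intvec.subspace_inter[OF V' subM]] M
    by blast
  have VM: "V \<inter> (K \<inter> M) = V \<inter> M" and WV: "W \<inter> (V \<inter> M) = V \<inter> W" using VK WM by auto
  have "K \<inter> M = {l + v | l v. l \<in> intvec.span (C1 \<union> C2) \<and> v \<in> V \<inter> W}" (is "_ = ?R")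
  proof (intro equalityI subsetI)
    fix x assume "x \<in> K \<inter> M"
    then obtain l y where l: "x = l + y" "l \<in> intvec.span C1" "y \<in> V \<inter> M"
      using C1(3) VM by blast
    then obtain m v where "y = m + v" "m \<in> intvec.span C2" "v \<in> V \<inter> W"
      using C2(3) WV by blast
    moreover have "x = (l + m) + v" using l calculation by (simp add: add.assoc)
    ultimately show "x \<in> ?R" using l unfolding intvec.span_Un by blast
  next
    fix x assume "x \<in> ?R"
    moreover have "intvec.span (C1 \<union> C2) \<subseteq> K \<inter> M"
      using C1(2) C2(2) VK
      by (intro intvec.span_minimal intvec.subspace_inter[OF subK subM]) auto
    ultimately show "x \<in> K \<inter> M"
      using VK WM intvec.subspace_add[OF intvec.subspace_inter[OF subK subM]] by blast
  qed
  moreover have "C1 \<union> C2 \<subseteq> vecs X"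
    using C1(2) C2(2) V(1) gen_number_lattice_imp_vecs[OF assms(1)] by blast
  ultimately show ?thesis
    unfolding gen_number_lattice_iff_span
    using C1(1) C2(1) V W ratvec.subspace_inter[OF V(2) W(2)]
    by (intro exI[of _ "C1 \<union> C2"] exI[of _ "V \<inter> W"]) auto
qed

text \<open>This frees the coordinates in \<open>Y\<close>: the full space \<open>vecs Y\<close> is
  absorbed into the subspace part, and the lattice generators stay the same.\<close>

lemma gen_number_lattice_add_vecs:
  assumes "gen_number_lattice X K"
  shows "gen_number_lattice (X \<union> Y) {k + y | k y. k \<in> K \<and> y \<in> vecs Y}"
proof -
  obtain B V where B: "finite B" "B \<subseteq> vecs X" and V: "V \<subseteq> vecs X" "ratvec.subspace V"
    and K: "K = {l + v | l v. l \<in> intvec.span B \<and> v \<in> V}"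
    using assms unfolding gen_number_lattice_iff_span by blast
  have vecs: "vecs X \<subseteq> vecs (X \<union> Y)" "vecs Y \<subseteq> vecs (X \<union> Y)" by (auto simp: vecs_def)
  let ?W = "{v + y | v y. v \<in> V \<and> y \<in> vecs Y}"
  have "?W \<subseteq> vecs (X \<union> Y)"
    using V(1) vecs ratvec.subspace_add[OF subspace_vecs] by blast
  moreover have "ratvec.subspace ?W" by (rule ratvec.subspace_sums[OF V(2) subspace_vecs])
  moreover have "{k + y | k y. k \<in> K \<and> y \<in> vecs Y} = {l + w | l w. l \<in> intvec.span B \<and> w \<in> ?W}"
    unfolding K by (auto simp: add.assoc) (metis add.assoc)+
  ultimately show ?thesis
    unfolding gen_number_lattice_iff_span
    using B(1) order_trans[OF B(2) vecs(1)] by (intro exI[of _ B] exI[of _ ?W]) (simp only:)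
qed

lemma gen_number_lattice_project:
  assumes "gen_number_lattice X K"
  shows "gen_number_lattice (X - Y) ((\<lambda>f x. if x \<in> Y then 0 else f x) ` K)"
proof -
  define p where "p = (\<lambda>(f :: 'a \<Rightarrow> rat) x. if x \<in> Y then 0 else f x)"
  obtain B V where B: "finite B" "B \<subseteq> vecs X" and V: "V \<subseteq> vecs X" "ratvec.subspace V"
    and K: "K = {l + v | l v. l \<in> intvec.span B \<and> v \<in> V}"
    using assms unfolding gen_number_lattice_iff_span by blast
  \<comment> \<open>Zeroing the coordinates in \<open>Y\<close> is linear over both rings:
    \<open>r\<close> transports the subspace part and \<open>i\<close> the integer span.\<close>
  interpret r: module_hom "vscale :: rat \<Rightarrow> ('a \<Rightarrow> rat) \<Rightarrow> 'a \<Rightarrow> rat" vscale p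
    by unfold_locales (auto simp: p_def vscale_def algebra_simps)
  interpret i: module_hom "\<lambda>n :: int. vscale (rat_of_int n) :: ('a \<Rightarrow> rat) \<Rightarrow> 'a \<Rightarrow> rat"
    "\<lambda>n :: int. vscale (rat_of_int n)" p
    by unfold_locales (auto simp: p_def vscale_def algebra_simps)
  have p_vecs: "p ` A \<subseteq> vecs (X - Y)" if "A \<subseteq> vecs X" for A
    using that by (auto simp: p_def vecs_def)
  have "p ` K = {l + v | l v. l \<in> p ` intvec.span B \<and> v \<in> p ` V}"
    unfolding K by (auto simp: r.add image_iff) (metis r.add)+
  then have "p ` K = {l + v | l v. l \<in> intvec.span (p ` B) \<and> v \<in> p ` V}"
    by (simp only: i.span_image)
  then have "gen_number_lattice (X - Y) (p ` K)"
    unfolding gen_number_lattice_iff_span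
    using B(1) p_vecs[OF B(2)] p_vecs[OF V(1)] r.subspace_image[OF V(2)] by blast
  then show ?thesis by (simp add: p_def)
qed

section \<open>Matched composition as a projection of an intersection\<close>

lemma vecs_Un_decompose:
  assumes "k \<in> vecs (A \<union> B)"
  obtains f g where "f \<in> vecs A" "g \<in> vecs B" "k = f + g"
proof
  show "(\<lambda>x. if x \<in> A then k x else 0) \<in> vecs A" "(\<lambda>x. if x \<in> A then 0 else k x) \<in> vecs B"
    "k = (\<lambda>x. if x \<in> A then k x else 0) + (\<lambda>x. if x \<in> A then 0 else k x)"
    using assms by (auto simp: vecs_def)
qed

text \<open>At each point at most one of the two summands can be nonzero. This is what makes a
  pointwise sum a faithful encoding of a pair.\<close>

lemma vecs_add_unique:
  assumes "A \<inter> B = {}" "f \<in> vecs A" "f' \<in> vecs A" "g \<in> vecs B" "g' \<in> vecs B" "f + g = f' + g'"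
  shows "f = f'" "g = g'"
proof -
  have "f x = f' x \<and> g x = g' x" for x
  proof -
    have "f x + g x = f' x + g' x" using fun_cong[OF assms(6), of x] by simp
    moreover have "x \<notin> A \<Longrightarrow> f x = 0 \<and> f' x = 0" "x \<notin> B \<Longrightarrow> g x = 0 \<and> g' x = 0" "x \<notin> A \<or> x \<notin> B"
      using assms(1-5) by (auto simp: vecs_def)
    ultimately show ?thesis by auto
  qed
  then show "f = f'" "g = g'" by auto
qed

text \<open>The definition only provides some splitting of the sum; disjointness of \<open>A\<close>
  and \<open>C\<close> forces it to be the given one.\<close>

lemma mem_matched_comp_iff:
  assumes "A \<inter> C = {}" "f \<in> vecs A" "g \<in> vecs C"
  shows "f + g \<in> matched_comp A B C K M \<longleftrightarrow> (\<exists>h \<in> vecs B. f + h \<in> K \<and> h + g \<in> M)"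
proof
  assume "f + g \<in> matched_comp A B C K M"
  then obtain f' g' h where "f + g = f' + g'" "f' \<in> vecs A" "g' \<in> vecs C"
    and h: "h \<in> vecs B" "f' + h \<in> K" "h + g' \<in> M"
    unfolding matched_comp_def by blast
  then have "f = f'" "g = g'" using vecs_add_unique[OF assms(1)] assms(2,3) by blast+
  then show "\<exists>h \<in> vecs B. f + h \<in> K \<and> h + g \<in> M" using h by blast
qed (use assms(2,3) in \<open>auto simp: matched_comp_def\<close>)

text \<open>View \<open>f + h + g\<close> as a triple on \<open>A\<close>, \<open>B\<close>,
  \<open>C\<close>. Extending \<open>K\<close> by \<open>vecs C\<close> constrains only
  \<open>f + h\<close>, and extending \<open>M\<close> by \<open>vecs A\<close> constrains only
  \<open>h + g\<close>. Intersecting imposes both conditions on the same \<open>h\<close>, and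
  zeroing \<open>B\<close> forgets it.\<close>

lemma matched_comp_eq_projection:
  assumes disj: "A \<inter> B = {}" "B \<inter> C = {}" "A \<inter> C = {}"
    and "K \<subseteq> vecs (A \<union> B)" "M \<subseteq> vecs (B \<union> C)"
  shows "matched_comp A B C K M = (\<lambda>f x. if x \<in> B then 0 else f x) `
    ({k + g | k g. k \<in> K \<and> g \<in> vecs C} \<inter> {m + f | m f. m \<in> M \<and> f \<in> vecs A})"
    (is "_ = ?p ` (?K \<inter> ?M)")
proof (intro equalityI subsetI)
  have p: "?p (f + h + g) = f + g" if "f \<in> vecs A" "h \<in> vecs B" "g \<in> vecs C" for f g h
  proof
    fix x
    have "x \<notin> A \<Longrightarrow> f x = 0" "x \<notin> B \<Longrightarrow> h x = 0" "x \<notin> C \<Longrightarrow> g x = 0"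
      "x \<in> B \<Longrightarrow> x \<notin> A \<and> x \<notin> C"
      using that disj by (auto simp: vecs_def)
    then show "?p (f + h + g) x = (f + g) x" by auto
  qed
  {
    fix x assume "x \<in> matched_comp A B C K M"
    then obtain f g h where fgh: "x = f + g" "f \<in> vecs A" "g \<in> vecs C" "h \<in> vecs B"
      "f + h \<in> K" "h + g \<in> M" unfolding matched_comp_def by blast
    moreover have "f + h + g = h + g + f" by (simp add: algebra_simps)
    ultimately have "f + h + g \<in> ?K \<inter> ?M" by blast
    moreover have "x = ?p (f + h + g)" using p[OF fgh(2,4,3)] fgh(1) by (simp only:)
    ultimately show "x \<in> ?p ` (?K \<inter> ?M)" by (intro image_eqI[where x = "f + h + g"])
  next
    fix x assume "x \<in> ?p ` (?K \<inter> ?M)"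
    then obtain k g m a where x: "x = ?p (k + g)" "k + g = m + a"
      "k \<in> K" "g \<in> vecs C" "m \<in> M" "a \<in> vecs A" by blast
    obtain f h where k: "f \<in> vecs A" "h \<in> vecs B" "k = f + h"
      using vecs_Un_decompose[of k A B] x assms by blast
    obtain h' g' where m: "h' \<in> vecs B" "g' \<in> vecs C" "m = h' + g'"
      using vecs_Un_decompose[of m B C] x assms by blast
    \<comment> \<open>Grouping the \<open>B\<close> and \<open>C\<close> parts together lets
      uniqueness identify \<open>h + g\<close> with \<open>m\<close>.\<close>
    have "f + (h + g) = a + (h' + g')" using x(2) k m by (simp add: algebra_simps)
    moreover have "h + g \<in> vecs (B \<union> C)" "h' + g' \<in> vecs (B \<union> C)" "A \<inter> (B \<union> C) = {}"
      using k m x disj by (auto simp: vecs_def)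
    ultimately have "h + g = h' + g'" using vecs_add_unique(2)[of A "B \<union> C"] k x by blast
    then have "h + g \<in> M" using m x by simp
    moreover have "x = f + g" using p[OF k(1,2) x(4)] k(3) x(1) by (simp only:)
    ultimately show "x \<in> matched_comp A B C K M"
      using k x unfolding matched_comp_def by blast
  }
qed

lemma gen_number_lattice_matched_comp:
  assumes disj: "A \<inter> B = {}" "B \<inter> C = {}" "A \<inter> C = {}"
    and K: "gen_number_lattice (A \<union> B) K" and M: "gen_number_lattice (B \<union> C) M"
  shows "gen_number_lattice (A \<union> C) (matched_comp A B C K M)"
proof -
  have X: "A \<union> B \<union> C - B = A \<union> C" "B \<union> C \<union> A = A \<union> B \<union> C" using disj by auto
  note K' = gen_number_lattice_add_vecs[OF K, of C]
  note M' = gen_number_lattice_add_vecs[OF M, of A, unfolded X(2)]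
  show ?thesis
    using gen_number_lattice_project[OF gen_number_lattice_Int[OF K' M'], of B]
    unfolding X(1) matched_comp_eq_projection[OF disj gen_number_lattice_imp_vecs[OF K]
      gen_number_lattice_imp_vecs[OF M]] .
qed

section \<open>Restriction, contraction and double composition\<close>

lemma restriction_matched_comp_subset:
  assumes "S \<inter> Q = {}"
  shows "restriction (matched_comp S P Q K M) S Q \<subseteq> restriction K S P"
  unfolding restriction_def using mem_matched_comp_iff[OF assms] by blast

text \<open>The zero vector on \<open>P\<close> serves as the shared vector, matched with the zero
  element of \<open>M\<close>.\<close>

lemma contraction_subset_matched_comp:
  assumes "0 \<in> M"
  shows "contraction K S \<subseteq> contraction (matched_comp S P Q K M) S"
proof
  fix f assume "f \<in> contraction K S"
  then have "f \<in> vecs S" "f + 0 \<in> K" by (auto simp: contraction_def)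
  moreover have "0 \<in> vecs P" "0 \<in> vecs Q" "0 + 0 \<in> M" using assms by (auto simp: vecs_def)
  ultimately have "f + 0 \<in> matched_comp S P Q K M" unfolding matched_comp_def by blast
  then show "f \<in> contraction (matched_comp S P Q K M) S"
    using \<open>f \<in> vecs S\<close> by (simp add: contraction_def)
qed

text \<open>Passing through \<open>K\<close> twice can replace \<open>f'\<close> by \<open>f\<close>
  only if both match the same \<open>h\<close>. Then \<open>f - f'\<close> lies in the contraction
  of \<open>K\<close>, hence in \<open>M\<close>, so the replacement stays in \<open>M\<close>.
  Conversely, the restriction inclusion gives each element of \<open>M\<close> an \<open>h\<close>
  through which it returns to itself.\<close>

lemma matched_comp_matched_comp:
  assumes disj: "S \<inter> Q = {}" "P \<inter> Q = {}"
    and K: "intvec.subspace K" and M: "intvec.subspace M" "M \<subseteq> vecs (S \<union> Q)"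
    and restr: "restriction M S Q \<subseteq> restriction K S P"
    and contr: "contraction K S \<subseteq> contraction M S"
  shows "matched_comp S P Q K (matched_comp P S Q K M) = M"
proof (intro equalityI subsetI)
  fix x assume "x \<in> matched_comp S P Q K (matched_comp P S Q K M)"
  then obtain f g h where x: "x = f + g" "f \<in> vecs S" "g \<in> vecs Q" "h \<in> vecs P" "f + h \<in> K"
    "h + g \<in> matched_comp P S Q K M" unfolding matched_comp_def[of S] by blast
  then obtain f' where f': "f' \<in> vecs S" "h + f' \<in> K" "f' + g \<in> M"
    using mem_matched_comp_iff[OF disj(2)] by blast
  have "f - f' = (f + h) - (h + f')" by simp
  then have "f - f' \<in> K" using intvec.subspace_diff[OF K x(5) f'(2)] by simp
  moreover have "f - f' \<in> vecs S" using x(2) f'(1) by (simp add: ratvec.subspace_diff subspace_vecs)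
  ultimately have "f - f' \<in> M" using contr by (auto simp: contraction_def)
  moreover have "x = (f - f') + (f' + g)" using x(1) by simp
  ultimately show "x \<in> M" using intvec.subspace_add[OF M(1) _ f'(3)] by blast
next
  fix x assume "x \<in> M"
  then obtain f g where x: "f \<in> vecs S" "g \<in> vecs Q" "x = f + g"
    using M(2) vecs_Un_decompose by blast
  then have "f \<in> restriction K S P"
    using \<open>x \<in> M\<close> restr by (auto simp: restriction_def)
  then obtain h where h: "h \<in> vecs P" "f + h \<in> K" by (auto simp: restriction_def)
  then have "h + g \<in> matched_comp P S Q K M"
    using x \<open>x \<in> M\<close> mem_matched_comp_iff[OF disj(2)] by (metis add.commute)
  then show "x \<in> matched_comp S P Q K (matched_comp P S Q K M)"
    using x h mem_matched_comp_iff[OF disj(1)] by blast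
qed

theorem theorem3:
  fixes S P Q :: "'a set"
    and K_SP K_SQ :: "('a \<Rightarrow> rat) set"
  assumes "finite S" and "finite P" and "finite Q"
    and "S \<inter> P = {}" and "P \<inter> Q = {}" and "S \<inter> Q = {}"
    and "gen_number_lattice (S \<union> P) K_SP"
    and "gen_number_lattice (S \<union> Q) K_SQ"
  shows
    "((\<exists>K_PQ. gen_number_lattice (P \<union> Q) K_PQ \<and> matched_comp S P Q K_SP K_PQ = K_SQ) \<longleftrightarrow>
        restriction K_SP S P \<supseteq> restriction K_SQ S Q \<and>
        contraction K_SP S \<subseteq> contraction K_SQ S)
     \<and>
     (\<forall>K_PQ. gen_number_lattice (P \<union> Q) K_PQ \<longrightarrow> matched_comp S P Q K_SP K_PQ = K_SQ \<longrightarrow>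
        (matched_comp P S Q K_SP K_SQ = K_PQ \<longleftrightarrow>
           restriction K_SP P S \<supseteq> restriction K_PQ P Q \<and>
           contraction K_SP P \<subseteq> contraction K_PQ P))
     \<and>
     (\<forall>K_PQ. gen_number_lattice (P \<union> Q) K_PQ \<and> matched_comp S P Q K_SP K_PQ = K_SQ \<and>
        restriction K_SP P S \<supseteq> restriction K_PQ P Q \<and>
        contraction K_SP P \<subseteq> contraction K_PQ P \<longrightarrow>
        (\<forall>K'. gen_number_lattice (P \<union> Q) K' \<and> matched_comp S P Q K_SP K' = K_SQ \<and>
           restriction K_SP P S \<supseteq> restriction K' P Q \<and>
           contraction K_SP P \<subseteq> contraction K' P \<longrightarrow> K' = K_PQ))"
proof -
  note SP = assms(7) and SQ = assms(8)
  have zero: "0 \<in> M" if "gen_number_lattice X M" for X :: "'a set" and M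
    using gen_number_lattice_imp_subspace[OF that] by (rule intvec.subspace_0)
  let ?M = "matched_comp P S Q K_SP K_SQ"
  \<comment> \<open>Here \<open>S\<close> is the shared set. Vectors are extended by zero, so
    \<open>K_SP\<close> serves unchanged in either orientation.\<close>
  have M: "gen_number_lattice (P \<union> Q) ?M"
    using gen_number_lattice_matched_comp[of P S Q] assms by (simp add: Un_commute Int_commute)
  have exists: "(\<exists>K_PQ. gen_number_lattice (P \<union> Q) K_PQ \<and> matched_comp S P Q K_SP K_PQ = K_SQ) \<longleftrightarrow>
      restriction K_SP S P \<supseteq> restriction K_SQ S Q \<and> contraction K_SP S \<subseteq> contraction K_SQ S"
    (is "?L \<longleftrightarrow> ?R")
  proof
    assume ?L
    then show ?R
      using restriction_matched_comp_subset[OF assms(6)] contraction_subset_matched_comp zero by metis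
  next
    assume ?R
    then have "matched_comp S P Q K_SP ?M = K_SQ"
      using matched_comp_matched_comp[OF assms(6,5)] SP SQ
        gen_number_lattice_imp_subspace gen_number_lattice_imp_vecs by blast
    then show ?L using M by blast
  qed
  have recover: "?M = K_PQ \<longleftrightarrow>
      restriction K_SP P S \<supseteq> restriction K_PQ P Q \<and> contraction K_SP P \<subseteq> contraction K_PQ P"
    (is "?L \<longleftrightarrow> ?R")
    if PQ: "gen_number_lattice (P \<union> Q) K_PQ" and eq: "matched_comp S P Q K_SP K_PQ = K_SQ" for K_PQ
  proof
    assume ?L
    then show ?R
      using restriction_matched_comp_subset[OF assms(5)]
        contraction_subset_matched_comp[OF zero[OF SQ]] by metis
  next
    \<comment> \<open>As \<open>K_SQ\<close> is itself a composition with \<open>K_SP\<close>, this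
      is the double composition identity with \<open>S\<close> and \<open>P\<close>
      exchanged.\<close>
    assume ?R
    then show ?L
      using matched_comp_matched_comp[OF assms(5,6), of K_SP K_PQ] SP PQ eq
        gen_number_lattice_imp_subspace gen_number_lattice_imp_vecs by blast
  qed
  show ?thesis
  proof (intro conjI[OF exists] conjI allI impI)
    fix K_PQ assume "gen_number_lattice (P \<union> Q) K_PQ" "matched_comp S P Q K_SP K_PQ = K_SQ"
    then show "?M = K_PQ \<longleftrightarrow>
      restriction K_SP P S \<supseteq> restriction K_PQ P Q \<and> contraction K_SP P \<subseteq> contraction K_PQ P"
      by (rule recover)
  \<comment> \<open>By \<open>recover\<close>, any two admissible solutions both equal
    \<open>?M\<close>, which depends only on \<open>K_SP\<close> and \<open>K_SQ\<close>.\<close>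
  qed (metis recover)
qed

end
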